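(* Let $\gamma=1$ and let $\alpha,\beta\in[0,1]$ with $\alpha,\beta\ne1$ and $\alpha+\beta>1$. Let $X_j^n$ be the forest-fire random field with parameters $\alpha,\beta,\gamma$, and let $Y_n=\sum_{j=0}^n X_j^n$ for $n\ge0$. Then $$\mathbb{P}\{Y_n=0\}\ \le\ \frac{n}{n+1}\,(2-\alpha-\beta)\qquad\text{for all } n\ge0,$$ and hence $$\lim_{n\to\infty}\mathbb{P}\{Y_n=0\}\ \le\ 2-\alpha-\beta.$$
   Context: Forest-fire random field with parameters $\alpha,\beta,\gamma$, where $0\le\alpha,\beta\le\gamma\le1$: $\mathbb{N}=\{0,1,2,\ldots\}$. A family of $\{0,1\}$-valued random variables $X(j,k)$, $j,k\in\mathbb{N}$, is given on a probability space; write $X_j^n=X(j,n-j)$ for $0\le j\le n$. Boundary conditions: $X(0,0)=1$ and $X(j,-1)=X(-1,k)=0$ for all $j,k\in\mathbb{N}$, i.e. $X_0^0=1$ and $X_{-1}^n=X_{n+1}^n=0$ for all $n\ge0$. Let $\mathcal{F}_n=\sigma(X_j^m:\ 0\le j\le m\le n)$. The law of the field is defined inductively: for every $n\ge0$, given $\mathcal{F}_n$, the variables $X_0^{n+1},\ldots,X_{n+1}^{n+1}$ are conditionally independent, and for each $0\le j\le n+1$ the conditional law of $X_j^{n+1}$ given $\mathcal{F}_n$ depends only on $(X_{j-1}^n,X_j^n)$: the conditional probability that $X_j^{n+1}=1$ equals $0$ if $(X_{j-1}^n,X_j^n)=(0,0)$, equals $\alpha$ if it is $(1,0)$, equals $\beta$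 if it is $(0,1)$, and equals $\gamma$ if it is $(1,1)$. Up to null sets $\{Y_n=0\}\subset\{Y_{n+1}=0\}$, so $\mathbb{P}\{Y_n=0\}$ is nondecreasing in $n$ and its limit exists. *)

theory Defs
  imports "HOL-Probability.Probability"
begin

definition cprob :: "'a measure \<Rightarrow> 'a measure \<Rightarrow> 'a set \<Rightarrow> 'a \<Rightarrow> real" where
  "cprob M F A = real_cond_exp M F (indicator A)"

text \<open>Conditional independence, given the sub-sigma-algebra \<open>F\<close>, of a family of random
  variables \<open>Z i\<close> with values in \<open>N i\<close>.\<close>

definition cond_indep_vars ::
  "'a measure \<Rightarrow> 'a measure \<Rightarrow> ('i \<Rightarrow> 'b measure) \<Rightarrow> ('i \<Rightarrow> 'a \<Rightarrow> 'b) \<Rightarrow> 'i set \<Rightarrow> bool" where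
  "cond_indep_vars M F N Z I \<longleftrightarrow>
     (\<forall>i\<in>I. Z i \<in> measurable M (N i)) \<and>
     (\<forall>J A. J \<subseteq> I \<and> J \<noteq> {} \<and> finite J \<and> (\<forall>i\<in>J. A i \<in> sets (N i)) \<longrightarrow>
        (AE \<omega> in M. cprob M F {\<omega>' \<in> space M. \<forall>i\<in>J. Z i \<omega>' \<in> A i} \<omega> =
                     (\<Prod>i\<in>J. cprob M F {\<omega>' \<in> space M. Z i \<omega>' \<in> A i} \<omega>)))"

text \<open>\<open>diag X n j\<close> is $X_j^n = X(j, n-j)$. The index \<open>j\<close> is an integer so that
  the boundary values $X_{-1}^n = X_{n+1}^n = 0$ are included.\<close>

definition diag :: "(nat \<Rightarrow> nat \<Rightarrow> 'a \<Rightarrow> nat) \<Rightarrow> nat \<Rightarrow> int \<Rightarrow> 'a \<Rightarrow> nat" where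
  "diag X n j \<omega> = (if 0 \<le> j \<and> j \<le> int n then X (nat j) (n - nat j) \<omega> else 0)"

definition field_filtration :: "'a measure \<Rightarrow> (nat \<Rightarrow> nat \<Rightarrow> 'a \<Rightarrow> nat) \<Rightarrow> nat \<Rightarrow> 'a measure" where
  "field_filtration M X n =
     sigma (space M)
       {diag X m j -` A \<inter> space M | m j A. 0 \<le> j \<and> j \<le> int m \<and> m \<le> n \<and> A \<subseteq> {0, 1}}"

fun fire_prob :: "real \<Rightarrow> real \<Rightarrow> real \<Rightarrow> nat \<times> nat \<Rightarrow> real" where
  "fire_prob \<alpha> \<beta> \<gamma> (x, y) =
     (if x = 1 then (if y = 1 then \<gamma> else \<alpha>) else (if y = 1 then \<beta> else 0))"

locale forest_fire_field = prob_space M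
  for M :: "'a measure" and \<alpha> \<beta> \<gamma> :: real and X :: "nat \<Rightarrow> nat \<Rightarrow> 'a \<Rightarrow> nat" +
  assumes param_nonneg: "0 \<le> \<alpha>" "0 \<le> \<beta>"
    and param_le: "\<alpha> \<le> \<gamma>" "\<beta> \<le> \<gamma>" "\<gamma> \<le> 1"
    and rv: "\<And>j k. X j k \<in> measurable M (count_space {0, 1})"
    and origin: "\<And>\<omega>. \<omega> \<in> space M \<Longrightarrow> X 0 0 \<omega> = 1"
    and cond_indep: "\<And>n. cond_indep_vars M (field_filtration M X n) (\<lambda>_. count_space {0, 1})
           (diag X (Suc n)) {0..int (Suc n)}"
    and cond_law: "\<And>n j. 0 \<le> j \<Longrightarrow> j \<le> int (Suc n) \<Longrightarrow>
           AE \<omega> in M. cprob M (field_filtration M X n) {\<omega>' \<in> space M. diag X (Suc n) j \<omega>' = 1} \<omega> =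
             fire_prob \<alpha> \<beta> \<gamma> (diag X n (j - 1) \<omega>, diag X n j \<omega>)"

definition diag_sum :: "(nat \<Rightarrow> nat \<Rightarrow> 'a \<Rightarrow> nat) \<Rightarrow> nat \<Rightarrow> 'a \<Rightarrow> nat" where
  "diag_sum X n \<omega> = (\<Sum>j = 0..int n. diag X n j \<omega>)"

lemma (in forest_fire_field) subalgebra_field_filtration:
  "subalgebra M (field_filtration M X n)"
proof -
  have meas: "diag X m j -` A \<inter> space M \<in> sets M"
    if "0 \<le> j" "j \<le> int m" "A \<subseteq> {0, 1}" for m j A
  proof -
    have "diag X m j = X (nat j) (m - nat j)"
      using that by (auto simp: diag_def fun_eq_iff)
    then show ?thesis
      using measurable_sets[OF rv[of "nat j" "m - nat j"], of A] that by simp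
  qed
  let ?G = "{diag X m j -` A \<inter> space M | m j A.
               0 \<le> j \<and> j \<le> int m \<and> m \<le> n \<and> A \<subseteq> {0, 1}}"
  have "?G \<subseteq> sets M" using meas by blast
  moreover have "?G \<subseteq> Pow (space M)" by auto
  ultimately show ?thesis
    unfolding subalgebra_def field_filtration_def
    by (simp add: sets.sigma_sets_subset space_measure_of_conv)
qed

end

theory Submission
  imports Defs
begin

text \<open>Since \<open>\<gamma> = 1\<close>, the occupied sites of each diagonal form an interval \<open>{a..b}\<close>, whose endpoints
  perform independent Bernoulli walks with parameters \<open>1 - \<beta>\<close> and \<open>\<alpha>\<close> until the interval vanishes.
  By the reflection principle the probability of the interval \<open>{a..b}\<close> at time \<open>n\<close> is a difference of
  products of binomial weights \<open>u\<close>, \<open>v\<close>, and a ballot-type computation bounds it below by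
  \<open>(b - a + 1) / (n + 1) * (u a * v b)\<close>. This bound is nonpositive for \<open>a > b\<close>, so it may be summed over
  all pairs \<open>(a, b)\<close>; only the means of the two binomial laws enter, and the survival probability
  is at least \<open>(1 + n (\<alpha> + \<beta> - 1)) / (n + 1)\<close>.\<close>

section \<open>Binomial weights: ratio identity, mass and mean\<close>

text \<open>The binomial law with \<open>n\<close> trials and success probability \<open>x\<close>,
  given by conditioning on the last trial. The argument is an integer, so that shifts such as
  \<open>a - 1\<close> leave the support with value 0 instead of being truncated.\<close>

fun binw :: "real \<Rightarrow> nat \<Rightarrow> int \<Rightarrow> real" where
  "binw x 0 a = (if a = 0 then 1 else 0)"
| "binw x (Suc n) a = (1 - x) * binw x n a + x * binw x n (a - 1)"

lemma binw_outside: "a < 0 \<or> int n < a \<Longrightarrow> binw x n a = 0"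
  by (induction n arbitrary: a) auto

lemma binw_nonneg: "0 \<le> x \<Longrightarrow> x \<le> 1 \<Longrightarrow> 0 \<le> binw x n a"
  by (induction n arbitrary: a) auto

text \<open>The quotient of consecutive binomial weights, cross-multiplied so that
  \<open>x = 1\<close> and the ends of the support are covered too. The induction uses the
  hypothesis at \<open>a\<close> and at \<open>a - 1\<close>.\<close>

lemma binw_ratio:
  "(1 - x) * (of_int a + 1) * binw x n (a + 1) = x * (real n - of_int a) * binw x n a"
proof (induction n arbitrary: a)
  case 0
  then show ?case by (cases "a = -1") auto
next
  case (Suc n)
  have 1: "x * (real n - of_int a + 1) * binw x n (a - 1) = (1 - x) * of_int a * binw x n a"
    using Suc[of "a - 1"] by (simp add: algebra_simps)
  have "(1 - x) * (of_int a + 1) * binw x (Suc n) (a + 1)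
      = (1 - x) * ((1 - x) * (of_int a + 1) * binw x n (a + 1)) + x * (1 - x) * (of_int a + 1) * binw x n a"
    by (simp add: algebra_simps)
  also have "\<dots> = (1 - x) * (x * (real n + 1 - of_int a) * binw x n a) + x * ((1 - x) * of_int a * binw x n a)"
    unfolding Suc by (simp add: algebra_simps)
  also have "\<dots> = x * (real (Suc n) - of_int a) * binw x (Suc n) a"
    unfolding 1[symmetric] by (simp add: algebra_simps)
  finally show ?case .
qed

text \<open>Expectation of \<open>f\<close> conditioned on the last trial; \<open>f = 1\<close>
  yields the total mass and \<open>f = of_int\<close> the mean.\<close>

lemma sum_binw_Suc:
  "(\<Sum>a = 0..int (Suc n). binw x (Suc n) a * f a)
     = (1 - x) * (\<Sum>a = 0..int n. binw x n a * f a) + x * (\<Sum>a = 0..int n. binw x n a * f (a + 1))"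
proof -
  have 1: "(\<Sum>a = 0..int (Suc n). binw x n a * f a) = (\<Sum>a = 0..int n. binw x n a * f a)"
    by (rule sum.mono_neutral_right) (auto simp: binw_outside)
  have "(\<Sum>a = 0..int (Suc n). binw x n (a - 1) * f a) = (\<Sum>a = 1..int (Suc n). binw x n (a - 1) * f a)"
    by (rule sum.mono_neutral_right) (auto simp: binw_outside)
  also have "\<dots> = (\<Sum>a = 0..int n. binw x n a * f (a + 1))"
    by (rule sum.reindex_bij_witness[of _ "\<lambda>a. a + 1" "\<lambda>a. a - 1"]) auto
  finally have 2: "(\<Sum>a = 0..int (Suc n). binw x n (a - 1) * f a) = (\<Sum>a = 0..int n. binw x n a * f (a + 1))" .
  have "(\<Sum>a = 0..int (Suc n). binw x (Suc n) a * f a)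
      = (1 - x) * (\<Sum>a = 0..int (Suc n). binw x n a * f a)
        + x * (\<Sum>a = 0..int (Suc n). binw x n (a - 1) * f a)"
    unfolding sum_distrib_left sum.distrib[symmetric] by (rule sum.cong) (auto simp: algebra_simps)
  then show ?thesis
    unfolding 1 2 .
qed

lemma sum_binw: "(\<Sum>a = 0..int n. binw x n a) = 1"
proof (induction n)
  case (Suc n)
  then show ?case using sum_binw_Suc[of x n "\<lambda>_. 1"] by simp
qed simp

lemma mean_binw: "(\<Sum>a = 0..int n. binw x n a * of_int a) = real n * x"
proof (induction n)
  case (Suc n)
  then show ?case using sum_binw_Suc[of x n of_int] sum_binw[of x n]
    by (simp add: distrib_left sum.distrib) (simp add: algebra_simps)
qed simp

section \<open>Reflected weights of pairs of endpoints\<close>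

text \<open>The second term is the weight of the pairs of endpoint paths that cross before time \<open>n\<close>. Swapping
  the paths at the crossing matches their number with the binomial coefficients at \<open>a - 1\<close> and
  \<open>b + 1\<close>; the quotient corrects the step weights, which are still those for \<open>a\<close> and \<open>b\<close>.\<close>

definition refl_weight :: "real \<Rightarrow> real \<Rightarrow> nat \<Rightarrow> int \<Rightarrow> int \<Rightarrow> real" where
  "refl_weight \<alpha> \<beta> n a b = binw (1 - \<beta>) n a * binw \<alpha> n b
     - (1 - \<alpha>) * (1 - \<beta>) / (\<alpha> * \<beta>) * (binw (1 - \<beta>) n (a - 1) * binw \<alpha> n (b + 1))"

lemma refl_weight_outside: "a < 0 \<or> int n < b \<Longrightarrow> refl_weight \<alpha> \<beta> n a b = 0"
  by (auto simp: refl_weight_def binw_outside)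

text \<open>This is the recursion of two independent walks. It is linear and translation invariant,
  so the shifted second product satisfies it as well as the first.\<close>

lemma refl_weight_Suc:
  "refl_weight \<alpha> \<beta> (Suc n) a b =
     \<beta> * (1 - \<alpha>) * refl_weight \<alpha> \<beta> n a b + \<beta> * \<alpha> * refl_weight \<alpha> \<beta> n a (b - 1)
     + (1 - \<beta>) * (1 - \<alpha>) * refl_weight \<alpha> \<beta> n (a - 1) b
     + (1 - \<beta>) * \<alpha> * refl_weight \<alpha> \<beta> n (a - 1) (b - 1)"
proof -
  \<comment> \<open>By linearity the recursion holds for any constant in front of the second
    product, so the quotient can stay opaque.\<close>
  define c where "c = (1 - \<alpha>) * (1 - \<beta>) / (\<alpha> * \<beta>)"
  show ?thesis
    unfolding refl_weight_def c_def[symmetric] by (simp add: algebra_simps)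
qed

text \<open>The boundary condition at the moment of crossing, where the interval becomes empty. By
  \<open>binw_ratio\<close> both walks contribute the same factor \<open>(n - a + 1) / a\<close>,
  which cancels and leaves exactly the constant of the correction term.\<close>

lemma refl_weight_diagonal:
  assumes "0 < \<alpha>" "0 < \<beta>"
  shows "refl_weight \<alpha> \<beta> n a (a - 1) = 0"
proof (cases "1 \<le> a \<and> a \<le> int n")
  case False
  then show ?thesis
    by (cases "a \<le> 0") (auto simp: refl_weight_def binw_outside)
next
  case True
  \<comment> \<open>The common factor of the two ratio identities. It is nonzero for
    \<open>1 \<le> a \<le> n\<close>; for all other \<open>a\<close> both products vanish.\<close>
  define k where "k = (real n - of_int a + 1) * of_int a"
  have k: "k \<noteq> 0"
    using True by (auto simp: k_def)
  have 1: "\<beta> * of_int a * binw (1 - \<beta>) n a = (1 - \<beta>) * (real n - of_int a + 1) * binw (1 - \<beta>) n (a - 1)"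
    using binw_ratio[of "1 - \<beta>" "a - 1" n] by (simp add: algebra_simps)
  have 2: "(1 - \<alpha>) * of_int a * binw \<alpha> n a = \<alpha> * (real n - of_int a + 1) * binw \<alpha> n (a - 1)"
    using binw_ratio[of \<alpha> "a - 1" n] by (simp add: algebra_simps)
  have "k * (\<alpha> * \<beta> * (binw (1 - \<beta>) n a * binw \<alpha> n (a - 1)))
      = (\<beta> * of_int a * binw (1 - \<beta>) n a) * (\<alpha> * (real n - of_int a + 1) * binw \<alpha> n (a - 1))"
    by (simp add: k_def)
  also have "\<dots> = k * ((1 - \<alpha>) * (1 - \<beta>) * (binw (1 - \<beta>) n (a - 1) * binw \<alpha> n a))"
    unfolding 1 2[symmetric] by (simp add: k_def)
  finally have "\<alpha> * \<beta> * (binw (1 - \<beta>) n a * binw \<alpha> n (a - 1))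
      = (1 - \<alpha>) * (1 - \<beta>) * (binw (1 - \<beta>) n (a - 1) * binw \<alpha> n a)"
    using k by simp
  then show ?thesis
    using assms by (simp add: refl_weight_def field_simps)
qed

text \<open>The ratio identities express the subtracted term as a multiple of the first product. The
  remaining ballot factor is explicit, and bounding its denominator by
  \<open>(N + 1) * (N + 1)\<close> makes it affine in \<open>a\<close> and \<open>b\<close>.\<close>

lemma refl_weight_ge:
  assumes "0 < \<alpha>" "\<alpha> \<le> 1" "0 < \<beta>" "\<beta> \<le> 1" "0 \<le> a" "a \<le> b" "b \<le> int n"
  shows "refl_weight \<alpha> \<beta> n a b
    \<ge> (of_int b - of_int a + 1) / (real n + 1) * (binw (1 - \<beta>) n a * binw \<alpha> n b)"
proof -
  define w where "w = binw (1 - \<beta>) n a * binw \<alpha> n b"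
  define A B N where "A = real_of_int a" and "B = real_of_int b" and "N = real n"
  have AB: "0 \<le> A" "A \<le> B" "B \<le> N"
    using assms by (auto simp: A_def B_def N_def)
  have w: "0 \<le> w"
    unfolding w_def using assms by (intro mult_nonneg_nonneg binw_nonneg) auto
  have 1: "\<beta> * A * binw (1 - \<beta>) n a = (1 - \<beta>) * (N - A + 1) * binw (1 - \<beta>) n (a - 1)"
    using binw_ratio[of "1 - \<beta>" "a - 1" n] by (simp add: algebra_simps A_def N_def)
  have 2: "(1 - \<alpha>) * (B + 1) * binw \<alpha> n (b + 1) = \<alpha> * (N - B) * binw \<alpha> n b"
    using binw_ratio[of \<alpha> b n] by (simp add: B_def N_def)
  define k where "k = (N - A + 1) * (B + 1)"
  have k: "0 < k"
    using AB by (auto simp: k_def intro!: mult_pos_pos)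
  \<comment> \<open>The subtracted term multiplied by \<open>\<alpha> * \<beta>\<close>; multiplying
    further by \<open>k\<close> lets both ratio identities apply.\<close>
  define r where "r = (1 - \<alpha>) * (1 - \<beta>) * (binw (1 - \<beta>) n (a - 1) * binw \<alpha> n (b + 1))"
  have "k * r = ((1 - \<beta>) * (N - A + 1) * binw (1 - \<beta>) n (a - 1)) * ((1 - \<alpha>) * (B + 1) * binw \<alpha> n (b + 1))"
    by (simp add: k_def r_def)
  also have "\<dots> = \<alpha> * \<beta> * (A * (N - B)) * w"
    unfolding 1[symmetric] 2 by (simp add: w_def)
  finally have kr: "k * r = \<alpha> * \<beta> * (A * (N - B)) * w" .
  have "refl_weight \<alpha> \<beta> n a b = w - r / (\<alpha> * \<beta>)"
    by (simp add: refl_weight_def w_def r_def)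
  also have "r / (\<alpha> * \<beta>) = A * (N - B) / k * w"
    using kr k assms by (simp add: field_simps)
  finally have eq: "refl_weight \<alpha> \<beta> n a b = (1 - A * (N - B) / k) * w"
    by (simp add: algebra_simps)
  have "1 - A * (N - B) / k = (N + 1) * (B + 1 - A) / k"
    using k by (simp add: field_simps) (simp add: k_def algebra_simps)
  moreover have "(B - A + 1) / (N + 1) \<le> (N + 1) * (B + 1 - A) / k"
  proof -
    have "k \<le> (N + 1) * (N + 1)"
      unfolding k_def using AB by (intro mult_mono) auto
    then have "(B - A + 1) * k \<le> (B - A + 1) * ((N + 1) * (N + 1))"
      using AB by (intro mult_left_mono) auto
    then show ?thesis
      using k AB by (simp add: field_simps)
  qed
  ultimately show ?thesis
    unfolding eq w_def[symmetric] A_def[symmetric] B_def[symmetric] N_def[symmetric]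
    using w by (intro mult_right_mono) auto
qed

lemma sum_refl_weight_ge:
  assumes "0 < \<alpha>" "\<alpha> \<le> 1" "0 < \<beta>" "\<beta> \<le> 1"
  shows "(\<Sum>(a, b) \<in> {(a, b). 0 \<le> a \<and> a \<le> b \<and> b \<le> int n}. refl_weight \<alpha> \<beta> n a b)
    \<ge> (1 + real n * (\<alpha> + \<beta> - 1)) / (real n + 1)"
proof -
  let ?u = "binw (1 - \<beta>) n" and ?v = "binw \<alpha> n" and ?I = "{0..int n}"
  have u: "(\<Sum>a\<in>?I. ?u a) = 1" "(\<Sum>a\<in>?I. ?u a * of_int a) = real n * (1 - \<beta>)"
    and v: "(\<Sum>a\<in>?I. ?v a) = 1" "(\<Sum>a\<in>?I. ?v a * of_int a) = real n * \<alpha>"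
    by (rule sum_binw mean_binw)+
  let ?f = "\<lambda>a b. (of_int b - of_int a + 1) / (real n + 1) * (?u a * ?v b)"
  \<comment> \<open>Over the full square the sum is the expectation of \<open>b - a + 1\<close>
    under the product law, so it reduces to masses and means.\<close>
  have "(\<Sum>a\<in>?I. \<Sum>b\<in>?I. (of_int b - of_int a + 1) * (?u a * ?v b))
      = (\<Sum>a\<in>?I. ?u a * (real n * \<alpha> - of_int a + 1))"
  proof (rule sum.cong)
    fix a
    have "(\<Sum>b\<in>?I. (of_int b - of_int a + 1) * (?u a * ?v b))
        = ?u a * (\<Sum>b\<in>?I. ?v b * of_int b) + ?u a * (1 - of_int a) * (\<Sum>b\<in>?I. ?v b)"
      by (simp add: sum_distrib_left sum.distrib[symmetric] algebra_simps)
    then show "(\<Sum>b\<in>?I. (of_int b - of_int a + 1) * (?u a * ?v b)) = ?u a * (real n * \<alpha> - of_int a + 1)"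
      unfolding v by (simp add: algebra_simps)
  qed simp
  also have "\<dots> = (real n * \<alpha> + 1) * (\<Sum>a\<in>?I. ?u a) - (\<Sum>a\<in>?I. ?u a * of_int a)"
    by (simp add: sum_distrib_left sum_subtractf[symmetric] algebra_simps)
  also have "\<dots> = 1 + real n * (\<alpha> + \<beta> - 1)"
    unfolding u by (simp add: algebra_simps)
  finally have "(1 + real n * (\<alpha> + \<beta> - 1)) / (real n + 1) = (\<Sum>a\<in>?I. \<Sum>b\<in>?I. ?f a b)"
    by (simp add: sum_divide_distrib[symmetric])
  also have "\<dots> = (\<Sum>(a, b)\<in>?I \<times> ?I. ?f a b)"
    by (simp add: sum.cartesian_product)
  also have "\<dots> \<le> (\<Sum>(a, b)\<in>?I \<times> ?I. if a \<le> b then refl_weight \<alpha> \<beta> n a b else 0)"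
  proof (rule sum_mono, clarify)
    fix a b assume ab: "a \<in> ?I" "b \<in> ?I"
    show "?f a b \<le> (if a \<le> b then refl_weight \<alpha> \<beta> n a b else 0)"
    proof (cases "a \<le> b")
      case True
      then show ?thesis using refl_weight_ge[OF assms, of a b n] ab by simp
    next
      case False
      \<comment> \<open>Integrality matters: \<open>a > b\<close> alone would only give
        \<open>b - a + 1 < 1\<close>, whereas a nonpositive factor is required.\<close>
      then have "b + 1 \<le> a" by simp
      then have "real_of_int (b + 1) \<le> of_int a" by (simp only: of_int_le_iff)
      moreover have "0 \<le> ?u a * ?v b"
        using assms by (intro mult_nonneg_nonneg binw_nonneg) auto
      ultimately show ?thesis using False
        by (simp add: mult_nonpos_nonneg divide_nonpos_nonneg)
    qed
  qed
  also have "\<dots> = (\<Sum>(a, b) \<in> {(a, b). 0 \<le> a \<and> a \<le> b \<and> b \<le> int n}. refl_weight \<alpha> \<beta> n a b)"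
    by (rule sum.mono_neutral_cong_right) (auto split: if_splits)
  finally show ?thesis .
qed


section \<open>Configurations of a diagonal and their transition probabilities\<close>

text \<open>Vacant sites are prescribed as well as occupied ones, so different subsets of
  \<open>{0..int n}\<close> give disjoint events.\<close>

definition occ :: "'a measure \<Rightarrow> (nat \<Rightarrow> nat \<Rightarrow> 'a \<Rightarrow> nat) \<Rightarrow> nat \<Rightarrow> int set \<Rightarrow> 'a set" where
  "occ M X n S = {\<omega> \<in> space M. \<forall>j \<in> {0..int n}. diag X n j \<omega> = of_bool (j \<in> S)}"

lemma (in forest_fire_field) sets_filtration: "sets (field_filtration M X n) \<subseteq> sets M"
  using subalgebra_field_filtration by (simp add: subalgebra_def)

lemma (in forest_fire_field) occ_in_filtration: "occ M X n S \<in> sets (field_filtration M X n)"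
proof -
  have "diag X n j -` A \<inter> space M \<in> sets (field_filtration M X n)"
    if "j \<in> {0..int n}" "A \<subseteq> {0, 1}" for j A
  proof -
    have "{diag X m j -` A \<inter> space M | m j A. 0 \<le> j \<and> j \<le> int m \<and> m \<le> n \<and> A \<subseteq> {0, 1}} \<subseteq> Pow (space M)"
      by auto
    then show ?thesis
      unfolding field_filtration_def using that
      by (auto simp: sets_measure_of intro!: sigma_sets.Basic)
  qed
  then have "(\<Inter>j\<in>{0..int n}. diag X n j -` {of_bool (j \<in> S)} \<inter> space M) \<in> sets (field_filtration M X n)"
    by (intro sets.finite_INT) auto
  also have "(\<Inter>j\<in>{0..int n}. diag X n j -` {of_bool (j \<in> S)} \<inter> space M) = occ M X n S"
    by (auto simp: occ_def)
  finally show ?thesis .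
qed

lemma (in forest_fire_field) occ_sets [measurable]: "occ M X n S \<in> sets M"
  using occ_in_filtration sets_filtration by blast

lemma (in forest_fire_field) diag_measurable:
  "0 \<le> j \<Longrightarrow> j \<le> int n \<Longrightarrow> diag X n j \<in> measurable M (count_space {0, 1})"
  using rv[of "nat j" "n - nat j"] by (simp add: diag_def cong: measurable_cong)

lemma (in forest_fire_field) diag_eq_0_or_1:
  "\<omega> \<in> space M \<Longrightarrow> diag X n j \<omega> = 0 \<or> diag X n j \<omega> = 1"
  using measurable_space[OF rv[of "nat j" "n - nat j"]] by (auto simp: diag_def)

text \<open>The factor of site \<open>j\<close> in the transition from configuration
  \<open>S\<close> on one diagonal to \<open>T\<close> on the next.\<close>

definition step_prob :: "real \<Rightarrow> real \<Rightarrow> real \<Rightarrow> int set \<Rightarrow> int set \<Rightarrow> int \<Rightarrow> real" where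
  "step_prob \<alpha> \<beta> \<gamma> S T j =
     (let p = fire_prob \<alpha> \<beta> \<gamma> (of_bool (j - 1 \<in> S), of_bool (j \<in> S)) in if j \<in> T then p else 1 - p)"

lemma (in forest_fire_field) cprob_site:
  assumes j: "0 \<le> j" "j \<le> int (Suc n)" and S: "S \<subseteq> {0..int n}"
  shows "AE \<omega> in M. \<omega> \<in> occ M X n S \<longrightarrow>
    cprob M (field_filtration M X n) {\<omega>' \<in> space M. diag X (Suc n) j \<omega>' \<in> {of_bool (j \<in> T)}} \<omega>
      = step_prob \<alpha> \<beta> \<gamma> S T j"
proof -
  let ?F = "field_filtration M X n"
  interpret F: finite_measure_subalgebra M ?F
    by unfold_locales (rule subalgebra_field_filtration)
  let ?A = "\<lambda>i. {\<omega>' \<in> space M. diag X (Suc n) j \<omega>' = i}"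
  have A [measurable]: "?A i \<in> sets M" for i
  proof -
    have "?A i = diag X (Suc n) j -` ({i} \<inter> {0, 1}) \<inter> space M"
      using diag_eq_0_or_1 by fastforce
    then show ?thesis
      using measurable_sets[OF diag_measurable[OF j], of "{i} \<inter> {0, 1}"] by simp
  qed
  \<comment> \<open>Valid for every integer \<open>i\<close>: outside \<open>{0..int n}\<close> the
    boundary value 0 of \<open>diag\<close> agrees with \<open>S\<close>. This covers the parents
    \<open>-1\<close> and \<open>n + 1\<close> of the two end sites.\<close>
  have occD: "diag X n i \<omega> = of_bool (i \<in> S)" if "\<omega> \<in> occ M X n S" for i \<omega>
    using that S by (cases "i \<in> {0..int n}") (auto simp: occ_def diag_def)
  have 1: "AE \<omega> in M. \<omega> \<in> occ M X n S \<longrightarrow>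
      cprob M ?F (?A 1) \<omega> = fire_prob \<alpha> \<beta> \<gamma> (of_bool (j - 1 \<in> S), of_bool (j \<in> S))"
    using cond_law[OF j] by eventually_elim (simp add: occD)
  have int: "integrable M (indicator (?A i) :: _ \<Rightarrow> real)" "integrable M (\<lambda>_. 1 :: real)" for i
    by (rule integrable_real_indicator[OF A]) (auto simp: less_top[symmetric])
  have eq: "indicator (?A 0) \<omega> = (1 :: real) - indicator (?A 1) \<omega>" if "\<omega> \<in> space M" for \<omega>
    using diag_eq_0_or_1[OF that, of "Suc n" j] that by (auto simp: indicator_def)
  have c1: "AE \<omega> in M. real_cond_exp M ?F (indicator (?A 0)) \<omega>
      = real_cond_exp M ?F (\<lambda>\<omega>. 1 - indicator (?A 1) \<omega>) \<omega>"
    by (rule F.real_cond_exp_cong) (auto simp: eq)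
  have c2: "AE \<omega> in M. real_cond_exp M ?F (\<lambda>\<omega>. 1 - indicator (?A 1) \<omega>) \<omega>
      = real_cond_exp M ?F (\<lambda>_. 1) \<omega> - real_cond_exp M ?F (indicator (?A 1)) \<omega>"
    by (rule F.real_cond_exp_diff[OF int(2) int(1)])
  have c3: "AE \<omega> in M. real_cond_exp M ?F (\<lambda>_. 1) \<omega> = 1"
    by (rule F.real_cond_exp_F_meas) auto
  \<comment> \<open>The law prescribes only the probability of value 1; value 0 follows by
    complement and linearity of conditional expectation.\<close>
  have 0: "AE \<omega> in M. cprob M ?F (?A 0) \<omega> = 1 - cprob M ?F (?A 1) \<omega>"
    using c1 c2 c3 unfolding cprob_def by eventually_elim simp
  show ?thesis
  proof (cases "j \<in> T")
    case True
    then show ?thesis using 1 by (simp add: step_prob_def)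
  next
    case False
    from 0 1 show ?thesis
      by eventually_elim (use False in \<open>simp add: step_prob_def\<close>)
  qed
qed

text \<open>On the event of configuration \<open>S\<close> the conditional probability of
  \<open>T\<close> is almost surely a constant product. That event lies in the filtration, so
  integrating over it gives the joint probability.\<close>

lemma (in forest_fire_field) prob_occ_step:
  assumes S: "S \<subseteq> {0..int n}"
  shows "prob (occ M X n S \<inter> occ M X (Suc n) T)
    = prob (occ M X n S) * (\<Prod>j\<in>{0..int (Suc n)}. step_prob \<alpha> \<beta> \<gamma> S T j)"
proof -
  let ?F = "field_filtration M X n" and ?I = "{0..int (Suc n)}"
  let ?A = "occ M X n S" and ?B = "occ M X (Suc n) T"
  let ?c = "\<Prod>j\<in>?I. step_prob \<alpha> \<beta> \<gamma> S T j"
  interpret F: finite_measure_subalgebra M ?F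
    by unfold_locales (rule subalgebra_field_filtration)
  have B: "{\<omega> \<in> space M. \<forall>j\<in>?I. diag X (Suc n) j \<omega> \<in> {of_bool (j \<in> T)}} = ?B"
    by (auto simp: occ_def)
  have "AE \<omega> in M. cprob M ?F ?B \<omega>
      = (\<Prod>j\<in>?I. cprob M ?F {\<omega> \<in> space M. diag X (Suc n) j \<omega> \<in> {of_bool (j \<in> T)}} \<omega>)"
    using cond_indep[of n, unfolded cond_indep_vars_def, THEN conjunct2, rule_format,
        of ?I "\<lambda>j. {of_bool (j \<in> T)}"] unfolding B by auto
  moreover have "AE \<omega> in M. \<forall>j\<in>?I. \<omega> \<in> ?A \<longrightarrow>
      cprob M ?F {\<omega> \<in> space M. diag X (Suc n) j \<omega> \<in> {of_bool (j \<in> T)}} \<omega> = step_prob \<alpha> \<beta> \<gamma> S T j"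
    by (rule AE_finite_allI) (use cprob_site S in auto)
  ultimately have ae: "AE \<omega> in M. indicator ?A \<omega> * cprob M ?F ?B \<omega> = ?c * indicator ?A \<omega>"
    by eventually_elim (auto simp: indicator_def)
  have "prob (?A \<inter> ?B) = (\<integral>\<omega>. indicator ?A \<omega> * indicator ?B \<omega> \<partial>M)"
    by (simp add: indicator_inter_arith[symmetric])
  also have "\<dots> = (\<integral>\<omega>. indicator ?A \<omega> * cprob M ?F ?B \<omega> \<partial>M)"
    using F.real_cond_exp_intA[OF integrable_real_indicator[OF occ_sets] occ_in_filtration, of "Suc n" T S]
    by (simp add: less_top[symmetric] set_lebesgue_integral_def cprob_def)
  also have "\<dots> = (\<integral>\<omega>. ?c * indicator ?A \<omega> \<partial>M)"
    using ae by (intro integral_cong_AE)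
      (auto simp: cprob_def intro: measurable_from_subalg[OF subalgebra_field_filtration])
  also have "\<dots> = prob ?A * ?c"
    by simp
  finally show ?thesis .
qed

text \<open>The empty configuration is absorbing: every site factor from \<open>{}\<close> to
  \<open>{}\<close> equals 1.\<close>

lemma (in forest_fire_field) prob_occ_empty_mono:
  "prob (occ M X n {}) \<le> prob (occ M X (Suc n) {})"
proof -
  have "prob (occ M X n {}) = prob (occ M X n {} \<inter> occ M X (Suc n) {})"
    by (subst prob_occ_step) (auto simp: step_prob_def)
  also have "\<dots> \<le> prob (occ M X (Suc n) {})"
    by (intro finite_measure_mono) auto
  finally show ?thesis .
qed

section \<open>Evolution of an occupied interval\<close>

text \<open>Sites \<open>a + 1\<close> to \<open>b\<close> have two occupied parents and survive
  surely as \<open>\<gamma> = 1\<close>; sites outside \<open>{a..b + 1}\<close> have none.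
  Randomness remains only at \<open>a\<close>, kept with probability \<open>\<beta>\<close>, and at
  \<open>b + 1\<close>, gained with probability \<open>\<alpha>\<close>.\<close>

lemma (in forest_fire_field) prob_occ_interval_step:
  assumes "\<gamma> = 1" "0 \<le> a" "a \<le> b" "b \<le> int n" "a' \<in> {a, a + 1}" "b' \<in> {b, b + 1}"
  shows "prob (occ M X n {a..b} \<inter> occ M X (Suc n) {a'..b'})
    = prob (occ M X n {a..b}) * ((if a' = a then \<beta> else 1 - \<beta>) * (if b' = b then 1 - \<alpha> else \<alpha>))"
proof -
  let ?p = "step_prob \<alpha> \<beta> \<gamma> {a..b} {a'..b'}"
  have "(\<Prod>j\<in>{0..int (Suc n)}. ?p j) = (\<Prod>j\<in>{a, b + 1}. ?p j)"
    by (rule prod.mono_neutral_right) (use assms in \<open>auto simp: step_prob_def\<close>)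
  also have "\<dots> = (if a' = a then \<beta> else 1 - \<beta>) * (if b' = b then 1 - \<alpha> else \<alpha>)"
    using assms by (auto simp: step_prob_def)
  finally show ?thesis
    using assms by (subst prob_occ_step) auto
qed

lemma occ_disjoint:
  assumes "S \<subseteq> {0..int n}" "T \<subseteq> {0..int n}" "S \<noteq> T"
  shows "occ M X n S \<inter> occ M X n T = {}"
proof -
  obtain j where "j \<in> S \<longleftrightarrow> j \<notin> T" using assms by blast
  moreover from this have "j \<in> {0..int n}" using assms by blast
  ultimately show ?thesis by (auto simp: occ_def split: if_splits)
qed

lemma disjoint_occ_intervals:
  "disjoint_family_on (\<lambda>x. occ M X n {fst x..snd x}) {(a, b). 0 \<le> a \<and> a \<le> b \<and> b \<le> int n}"
  unfolding disjoint_family_on_def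
proof (intro ballI impI)
  fix x y :: "int \<times> int"
  assume x: "x \<in> {(a, b). 0 \<le> a \<and> a \<le> b \<and> b \<le> int n}"
    and y: "y \<in> {(a, b). 0 \<le> a \<and> a \<le> b \<and> b \<le> int n}" and "x \<noteq> y"
  have "{fst x..snd x} \<noteq> {fst y..snd y}"
    using x y \<open>x \<noteq> y\<close> by (auto simp: Icc_eq_Icc prod_eq_iff)
  moreover have "{fst x..snd x} \<subseteq> {0..int n}" "{fst y..snd y} \<subseteq> {0..int n}"
    using x y by auto
  ultimately show "occ M X n {fst x..snd x} \<inter> occ M X n {fst y..snd y} = {}"
    by (intro occ_disjoint)
qed

text \<open>Induction along the recursion of the reflected weight: predecessor pairs that are not
  intervals of the previous diagonal have weight 0, and the others are bounded by hypothesis.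
  Summing over at most four disjoint predecessor events bounds the probability from below.\<close>

lemma (in forest_fire_field) prob_occ_interval_ge:
  assumes "\<gamma> = 1" "0 < \<alpha>" "0 < \<beta>"
  shows "0 \<le> a \<Longrightarrow> a \<le> b \<Longrightarrow> b \<le> int n \<Longrightarrow> refl_weight \<alpha> \<beta> n a b \<le> prob (occ M X n {a..b})"
proof (induction n arbitrary: a b)
  case 0
  then have "a = 0" "b = 0" by auto
  moreover have "occ M X 0 {0..0} = space M"
    using origin by (auto simp: occ_def diag_def)
  ultimately show ?case
    by (simp add: prob_space refl_weight_def)
next
  case (Suc n)
  let ?W = "\<lambda>a' b'. occ M X n {a'..b'} \<inter> occ M X (Suc n) {a..b}"
  define e where "e a' b' = (if 0 \<le> a' \<and> a' \<le> b' \<and> b' \<le> int n then prob (occ M X n {a'..b'}) else 0)" for a' b'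
  \<comment> \<open>Each predecessor pair of \<open>a \<le> b\<close> satisfies
    \<open>a' \<le> b' + 1\<close>; equality is the crossing case of
    \<open>refl_weight_diagonal\<close>.\<close>
  have e: "refl_weight \<alpha> \<beta> n a' b' \<le> e a' b'" if "a' \<le> b' + 1" for a' b'
  proof (cases "0 \<le> a' \<and> a' \<le> b' \<and> b' \<le> int n")
    case True
    then show ?thesis using Suc.IH by (simp add: e_def)
  next
    case False
    then have "a' < 0 \<or> int n < b' \<or> b' = a' - 1" using that by auto
    then show ?thesis
      using refl_weight_outside refl_weight_diagonal assms False by (auto simp: e_def)
  qed
  let ?k = "\<lambda>(a', b'). (if a = a' then \<beta> else 1 - \<beta>) * (if b = b' then 1 - \<alpha> else \<alpha>)"
  let ?P = "{a, a - 1} \<times> {b, b - 1}"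
  let ?V = "{(a', b') \<in> ?P. 0 \<le> a' \<and> a' \<le> b' \<and> b' \<le> int n}"
  have "refl_weight \<alpha> \<beta> (Suc n) a b = (\<Sum>(a', b')\<in>?P. ?k (a', b') * refl_weight \<alpha> \<beta> n a' b')"
    by (simp add: sum.cartesian_product[symmetric] refl_weight_Suc algebra_simps)
  also have "\<dots> \<le> (\<Sum>(a', b')\<in>?P. ?k (a', b') * e a' b')"
    using Suc.prems assms param_le by (intro sum_mono) (auto intro!: mult_left_mono e)
  also have "\<dots> = (\<Sum>(a', b')\<in>?V. ?k (a', b') * e a' b')"
    by (rule sum.mono_neutral_right) (auto simp: e_def split: if_splits)
  also have "\<dots> = (\<Sum>x\<in>?V. prob (?W (fst x) (snd x)))"
  proof (rule sum.cong)
    fix x assume "x \<in> ?V"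
    then obtain a' b' where x: "x = (a', b')" "a' \<in> {a, a - 1}" "b' \<in> {b, b - 1}"
      and v: "0 \<le> a'" "a' \<le> b'" "b' \<le> int n"
      by auto
    have "prob (?W a' b') = e a' b' * ?k (a', b')"
      using x v assms by (subst prob_occ_interval_step) (auto simp: e_def)
    then show "(case x of (a', b') \<Rightarrow> ?k (a', b') * e a' b') = prob (?W (fst x) (snd x))"
      using x by simp
  qed simp
  also have "\<dots> = prob (\<Union>x\<in>?V. ?W (fst x) (snd x))"
  proof (rule finite_measure_finite_Union[symmetric])
    show "disjoint_family_on (\<lambda>x. ?W (fst x) (snd x)) ?V"
      \<comment> \<open>Disjointness is inherited from the previous diagonal, where the predecessor
        intervals differ.\<close>
      by (rule disjoint_family_on_bisimulation
          [OF disjoint_family_on_mono[OF _ disjoint_occ_intervals[of M X n]]]) auto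
    show "finite ?V"
      by (rule finite_subset[of _ ?P]) auto
  qed auto
  also have "\<dots> \<le> prob (occ M X (Suc n) {a..b})"
    by (intro finite_measure_mono) auto
  finally show ?case .
qed

section \<open>Extinction probability and its limit\<close>

lemma (in forest_fire_field) diag_sum_eq_0: "{\<omega> \<in> space M. diag_sum X n \<omega> = 0} = occ M X n {}"
  by (auto simp: diag_sum_def occ_def)

text \<open>The events of nonempty occupied intervals are disjoint and exclude extinction, so the
  summed weights bound the survival probability from below; taking complements turns
  \<open>1 + n * (\<alpha> + \<beta> - 1)\<close> into
  \<open>n * (2 - \<alpha> - \<beta>)\<close>.\<close>

lemma (in forest_fire_field) prob_extinct_le:
  assumes "\<gamma> = 1" "0 < \<alpha>" "0 < \<beta>"
  shows "prob (occ M X n {}) \<le> real n / real (n + 1) * (2 - \<alpha> - \<beta>)"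
proof -
  let ?V = "{(a, b). 0 \<le> a \<and> a \<le> b \<and> b \<le> int n}"
  let ?E = "\<lambda>x. occ M X n {fst x..snd x}"
  have fin: "finite ?V"
    by (rule finite_subset[of _ "{0..int n} \<times> {0..int n}"]) auto
  have "(1 + real n * (\<alpha> + \<beta> - 1)) / (real n + 1) \<le> (\<Sum>(a, b)\<in>?V. refl_weight \<alpha> \<beta> n a b)"
    using assms param_le by (intro sum_refl_weight_ge) auto
  also have "\<dots> \<le> (\<Sum>x\<in>?V. prob (?E x))"
    using prob_occ_interval_ge assms by (intro sum_mono) auto
  also have "\<dots> = prob (\<Union>x\<in>?V. ?E x)"
  proof (rule finite_measure_finite_Union[symmetric])
    show "disjoint_family_on ?E ?V"
      by (rule disjoint_occ_intervals)
  qed (use fin in auto)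
  also have "\<dots> \<le> prob (space M - occ M X n {})"
  proof (intro finite_measure_mono)
    show "(\<Union>x\<in>?V. ?E x) \<subseteq> space M - occ M X n {}"
      by (fastforce simp: occ_def)
  qed auto
  also have "\<dots> = 1 - prob (occ M X n {})"
    by (rule prob_compl) auto
  finally show ?thesis
    by (simp add: field_simps)
qed

theorem corollary1:
  fixes M :: "'a measure" and \<alpha> \<beta> \<gamma> :: real and X :: "nat \<Rightarrow> nat \<Rightarrow> 'a \<Rightarrow> nat"
  assumes "\<gamma> = 1"
    and "\<alpha> \<in> {0..1}" and "\<beta> \<in> {0..1}"
    and "\<alpha> \<noteq> 1" and "\<beta> \<noteq> 1" and "\<alpha> + \<beta> > 1"
    and "forest_fire_field M \<alpha> \<beta> \<gamma> X"
  shows "(\<forall>n. measure M {\<omega> \<in> space M. diag_sum X n \<omega> = 0} \<le> real n / real (n + 1) * (2 - \<alpha> - \<beta>)) \<and>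
         convergent (\<lambda>n. measure M {\<omega> \<in> space M. diag_sum X n \<omega> = 0}) \<and>
         lim (\<lambda>n. measure M {\<omega> \<in> space M. diag_sum X n \<omega> = 0}) \<le> 2 - \<alpha> - \<beta>"
proof -
  interpret forest_fire_field M \<alpha> \<beta> \<gamma> X by fact
  let ?h = "\<lambda>n. prob (occ M X n {})"
  \<comment> \<open>Since neither parameter exceeds 1, \<open>\<alpha> + \<beta> > 1\<close> forces
    both to be positive, as \<open>prob_extinct_le\<close> demands.\<close>
  have le: "?h n \<le> real n / real (n + 1) * (2 - \<alpha> - \<beta>)" for n
    using assms by (intro prob_extinct_le) auto
  have le': "?h n \<le> 2 - \<alpha> - \<beta>" for n
  proof -
    have "real n / real (n + 1) * (2 - \<alpha> - \<beta>) \<le> 1 * (2 - \<alpha> - \<beta>)"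
      using assms by (intro mult_right_mono) auto
    with le[of n] show ?thesis by simp
  qed
  have "incseq ?h"
    by (rule incseq_SucI) (rule prob_occ_empty_mono)
  then obtain l where l: "?h \<longlonglongrightarrow> l"
    by (rule incseq_convergent) (use le' in auto)
  then have "l \<le> 2 - \<alpha> - \<beta>"
    using le' by (intro LIMSEQ_le_const2) auto
  with l le show ?thesis
    unfolding diag_sum_eq_0 by (auto simp: convergent_def limI)
qed

end
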